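(* Let $k_0\in\mathbb{R}$ be a constant. For $\gamma>1$ and $\lambda\in\mathbb{R}$, define $$\mathcal{S}_\lambda(\gamma):=\left\{(z,\mathbf{q})\in\mathbb{R}\times\mathbb{R}^2:\ k_0+z-\mathfrak{B}(\rho_s(\mathbf{q}),\mathbf{q})\ge\lambda\right\},$$ where $$\mathfrak{B}(\rho,\mathbf{q})=\frac{|\mathbf{q}|^2}{2\rho^2}+\frac{\gamma\rho^{\gamma-1}}{\gamma-1},\qquad \rho_s(\mathbf{q})=\left(\frac{|\mathbf{q}|^2}{\gamma}\right)^{\frac1{\gamma+1}} .$$ Then the set $\mathcal{S}_\lambda(\gamma)$ is convex for any $\lambda>0$ and $\gamma\ge3$.
   Context: Convention: for $\mathbf{q}=\mathbf{0}$ one has $\rho_s(\mathbf{0})=0$ and $\mathfrak{B}(\rho_s(\mathbf{0}),\mathbf{0})$ is understood to be $0$ (since $\mathfrak{B}(\rho,\mathbf{0})=\frac{\gamma\rho^{\gamma-1}}{\gamma-1}$). *)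

theory Defs
  imports "HOL-Analysis.Analysis"
begin

definition bernoulli_fun :: "real \<Rightarrow> real \<Rightarrow> real ^ 2 \<Rightarrow> real" where
  "bernoulli_fun \<gamma> \<rho> q = (norm q)\<^sup>2 / (2 * \<rho>\<^sup>2) + \<gamma> * \<rho> powr (\<gamma> - 1) / (\<gamma> - 1)"

definition rho_s :: "real \<Rightarrow> real ^ 2 \<Rightarrow> real" where
  "rho_s \<gamma> q = ((norm q)\<^sup>2 / \<gamma>) powr (1 / (\<gamma> + 1))"

definition S_set :: "real \<Rightarrow> real \<Rightarrow> real \<Rightarrow> (real \<times> (real ^ 2)) set" where
  "S_set k\<^sub>0 lam \<gamma> = {(z, q). k\<^sub>0 + z - bernoulli_fun \<gamma> (rho_s \<gamma> q) q \<ge> lam}"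

text \<open>At q = 0 the density vanishes and the Bernoulli function is understood to be 0.
  Isabelle's conventions x / 0 = 0 and 0 powr a = 0 yield exactly these values.\<close>

lemma rho_s_zero: "rho_s \<gamma> 0 = 0"
  by (simp add: rho_s_def)

lemma bernoulli_fun_rho_s_zero: "bernoulli_fun \<gamma> (rho_s \<gamma> 0) 0 = 0"
  by (simp add: bernoulli_fun_def rho_s_zero)

end

theory Submission
  imports Defs
begin

text \<open>Since \<open>(norm q)\<^sup>2 = \<gamma> * \<rho>\<^sub>s powr (\<gamma> + 1)\<close>, the Bernoulli function at the sonic density
  is a positive multiple of \<open>norm q powr p\<close> with \<open>p = 2 (\<gamma> - 1) / (\<gamma> + 1)\<close>, and \<open>p \<ge> 1\<close> exactly
  when \<open>\<gamma> \<ge> 3\<close>. The set is thus, up to a shift in \<open>z\<close>, the epigraph of a convex function.\<close>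

text \<open>Norms can vanish, so the endpoint 0 has to be included; \<open>powr_convex\<close>
  settles two positive points.\<close>

lemma convex_on_powr_atLeast_0:
  fixes p :: real
  assumes "p \<ge> 1"
  shows "convex_on {0..} (\<lambda>x. x powr p)"
proof (rule convex_onI)
  \<comment> \<open>If one point is 0, the combination shrinks to c * x with 0 < c < 1, and c powr p
    \<le> c because p \<ge> 1.\<close>
  have zero: "(c * x) powr p \<le> c * x powr p" if "0 < c" "c < 1" "0 \<le> x" for c x :: real
  proof -
    have "c powr p \<le> c"
      using that powr_mono'[OF assms, of c] by simp
    thus ?thesis using that by (simp add: powr_mult mult_right_mono)
  qed
  fix t x y :: real
  assume "0 < t" "t < 1" "x \<in> {0..}" "y \<in> {0..}"
  then show "((1 - t) *\<^sub>R x + t *\<^sub>R y) powr p \<le> (1 - t) * x powr p + t * y powr p"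
    using zero[of t y] zero[of "1 - t" x] convex_onD[OF powr_convex[OF assms], of t x y]
    by (cases "x = 0"; cases "y = 0") auto
qed simp

text \<open>The triangle inequality survives the power because \<open>powr\<close> is monotone on
  nonnegative reals; convexity on the closed half-line does the rest.\<close>

lemma convex_on_norm_powr:
  fixes p :: real
  assumes "p \<ge> 1"
  shows "convex_on UNIV (\<lambda>x :: 'a :: real_normed_vector. norm x powr p)"
proof (rule convex_onI)
  fix t :: real and x y :: 'a
  assume t: "0 < t" "t < 1"
  have "norm ((1 - t) *\<^sub>R x + t *\<^sub>R y) \<le> (1 - t) * norm x + t * norm y"
    by (rule order_trans[OF norm_triangle_ineq]) (use t in simp)
  hence "norm ((1 - t) *\<^sub>R x + t *\<^sub>R y) powr p \<le> ((1 - t) * norm x + t * norm y) powr p"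
    using assms by (intro powr_mono2) auto
  also have "\<dots> \<le> (1 - t) * norm x powr p + t * norm y powr p"
    using convex_onD[OF convex_on_powr_atLeast_0[OF assms], of t "norm x" "norm y"] t by simp
  finally show "norm ((1 - t) *\<^sub>R x + t *\<^sub>R y) powr p
      \<le> (1 - t) * norm x powr p + t * norm y powr p" .
qed simp

lemma bernoulli_fun_rho_s:
  assumes "\<gamma> > 1"
  shows "bernoulli_fun \<gamma> (rho_s \<gamma> q) q =
    \<gamma> * (\<gamma> + 1) / (2 * (\<gamma> - 1)) * (1 / \<gamma>) powr ((\<gamma> - 1) / (\<gamma> + 1)) *
    norm q powr (2 * (\<gamma> - 1) / (\<gamma> + 1))"
proof (cases "q = 0")
  \<comment> \<open>Both sides are 0 here, the right one since 0 powr a = 0 for every a.\<close>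
  case True
  thus ?thesis by (simp add: bernoulli_fun_rho_s_zero)
next
  case False
  define \<rho> where "\<rho> = rho_s \<gamma> q"
  have \<rho>: "\<rho> > 0" using False assms by (simp add: \<rho>_def rho_s_def)
  have "\<rho> powr (\<gamma> + 1) = (norm q)\<^sup>2 / \<gamma>"
    using assms False by (simp add: \<rho>_def rho_s_def powr_powr)
  \<comment> \<open>This turns the kinetic term into \<gamma> / 2 times \<rho> powr (\<gamma> - 1),
    the same power as in the enthalpy term.\<close>
  hence q: "(norm q)\<^sup>2 = \<gamma> * \<rho> powr (\<gamma> - 1) * \<rho>\<^sup>2"
    using assms \<rho> powr_add[of \<rho> "\<gamma> - 1" 2] by (simp add: field_simps powr_numeral)
  have "\<rho> powr (\<gamma> - 1) = ((norm q)\<^sup>2 * (1 / \<gamma>)) powr ((\<gamma> - 1) / (\<gamma> + 1))"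
    by (simp add: \<rho>_def rho_s_def powr_powr)
  also have "\<dots> = (norm q) powr (2 * (\<gamma> - 1) / (\<gamma> + 1)) * (1 / \<gamma>) powr ((\<gamma> - 1) / (\<gamma> + 1))"
    using False assms by (subst powr_mult) (simp_all add: powr_powr flip: powr_numeral)
  finally have r: "\<rho> powr (\<gamma> - 1) =
      norm q powr (2 * (\<gamma> - 1) / (\<gamma> + 1)) * (1 / \<gamma>) powr ((\<gamma> - 1) / (\<gamma> + 1))" .
  \<comment> \<open>The factor is \<gamma> * (1 / 2 + 1 / (\<gamma> - 1)).\<close>
  have "bernoulli_fun \<gamma> \<rho> q = \<gamma> * (\<gamma> + 1) / (2 * (\<gamma> - 1)) * \<rho> powr (\<gamma> - 1)"
    using assms \<rho> unfolding bernoulli_fun_def q by (simp add: field_simps)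
  thus ?thesis unfolding r by (simp add: \<rho>_def mult_ac)
qed

theorem proposition8:
  fixes k\<^sub>0 lam \<gamma> :: real
  assumes "lam > 0" and "\<gamma> \<ge> 3"
  shows "convex (S_set k\<^sub>0 lam \<gamma>)"
proof -
  let ?f = "\<lambda>q. bernoulli_fun \<gamma> (rho_s \<gamma> q) q"
  have "convex_on UNIV (\<lambda>q :: real ^ 2. norm q powr (2 * (\<gamma> - 1) / (\<gamma> + 1)))"
    using assms(2) by (intro convex_on_norm_powr) (simp add: field_simps)
  hence f: "convex_on UNIV ?f"
    using assms(2) by (subst bernoulli_fun_rho_s) (auto intro!: convex_on_cmul)
  show ?thesis
  proof (rule convexI)
    fix x y and u v :: real
    assume xy: "x \<in> S_set k\<^sub>0 lam \<gamma>" "y \<in> S_set k\<^sub>0 lam \<gamma>" and uv: "0 \<le> u" "0 \<le> v" "u + v = 1"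
    obtain z q z' q' where [simp]: "x = (z, q)" "y = (z', q')" by (cases x, cases y)
    have le: "?f q \<le> k\<^sub>0 + z - lam" "?f q' \<le> k\<^sub>0 + z' - lam"
      using xy by (auto simp: S_set_def)
    have "?f (u *\<^sub>R q + v *\<^sub>R q') \<le> u * ?f q + v * ?f q'"
      using f uv by (auto simp: convex_on_def)
    also have "\<dots> \<le> u * (k\<^sub>0 + z - lam) + v * (k\<^sub>0 + z' - lam)"
      using le uv by (intro add_mono mult_left_mono)
    also have "\<dots> = (u + v) * (k\<^sub>0 - lam) + u * z + v * z'"
      by (simp add: algebra_simps)
    finally show "u *\<^sub>R x + v *\<^sub>R y \<in> S_set k\<^sub>0 lam \<gamma>"
      using uv(3) by (simp add: S_set_def)
  qed
qed

end
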